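(* Let $H$ be a Hilbert space, let $F:\mathscr{D}(F)\subseteq U\to H$ and $h$ satisfy (A1)–(A7) of the context, and let $\bar u$, $\xi\in\partial h(\bar u)$, $\rho>0$ and $c>0$ satisfy the nonlinearity assumption (N) of the context, where the $h$-minimizing solution $\bar u$ lies in the interior of $\mathscr{D}(F)$. Assume that there exists $\omega\in U$ such that $\xi=F'(\bar u)^*F'(\bar u)\omega\in\partial h(\bar u)$ and $c\,\|F'(\bar u)\omega\|<1$. Assume moreover that $h$ is twice differentiable in a neighborhood $V$ of $\bar u$ and that there is a number $M>0$ such that $\langle h''(u)v,v\rangle\le M\|v\|^2$ for all $u\in V$ and all $v\in U$. For $\alpha,\delta>0$ and $y^\delta\in H$ with $\|y-y^\delta\|<\delta$, let $u_\alpha^\delta$ be a minimizer of $J_\alpha^\delta(u)=\frac12\|F(u)-y^\delta\|^2+\alpha h(u)$, and let $u_\alpha$ be a minimizer of $J_\alpha(u)=\frac12\|F(u)-y\|^2+\alpha h(u)$ (exact data). Then for the parameter choice $\alpha\sim\delta^{2/3}$ one has $$D_h^\xi(u_\alpha^\delta,\bar u)=O(\delta^{4/3})\quad(\delta\to0),$$ while for exact data $$D_h^\xi(u_\alpha,\bar u)=O(\alpha^2)\quad(\alpha\to0).$$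
   Context: $U$ is a Banach space and $H$ a Hilbert space (infinite-dimensional), with duals $U^*,H^*$, and $H^*$ identified with $H$; $\langle\cdot,\cdot\rangle$ is the duality pairing of $U^*\times U$; $y\in H$ is the exact datum of the equation $F(u)=y$. $\alpha\sim\delta^{2/3}$ means that $\alpha=\alpha(\delta)$ is of the same order as $\delta^{2/3}$ (the ratio is bounded above and below by positive constants). Standing assumptions. (A1) $U$ and $H$ carry topologies $\tau_U$ and $\tau_H$, respectively, weaker than the norm topologies. (A2) The topological duals of $U$, $H$ are denoted $U^*$, $H^*$. (A3) The norm of $H$ is sequentially lower semicontinuous with respect to $\tau_H$. (A4) $\mathscr{D}(F)$ has non-empty interior in the norm topology and is $\tau_U$-closed; $\mathscr{D}(F)\cap\operatorname{dom}h\ne\emptyset$. (A5) $F:\mathscr{D}(F)\subseteq U\to H$ is continuous from $(U,\tau_U)$ to $(H,\tau_H)$. (A6) $h:U\to[0,+\infty]$ is proper, convex, bounded from below and $\tau_U$-lower semicontinuous; $\operatorname{dom}h=\{u: h(u)<\infty\}$. (A7) For all $M'>0$, $\alpha>0$ the set $\{u : J_\alpha^\delta(u)\le M'\}$ (with the data in question; $J_\alpha$ for exact data) is $\tau_U$-compact in the sense that every sequence in it has a $\tau_U$-convergent subsequence. Here the functionals are considered on $\mathscr{D}(F)$. $h$-minimizing solution: $\bar u\in\operatorname{dom}h\cap\mathscr{D}(F)$ with $F(\bar u)=y$ that minimizes $h$ among all $u$ with $F(u)=y$. Bregman distance: for $u,v\in\operatorname{dom}h$ and $\xi\in\partial h(u)\subseteq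 U^*$ (subdifferential), $D_h^\xi(v,u)=h(v)-h(u)-\langle\xi,v-u\rangle$. Assumption (N): an $h$-minimizing solution $\bar u$ of $F(u)=y$ exists, $F$ is Gâteaux differentiable, and there are $\rho>0$, $c>0$ and $\xi\in\partial h(\bar u)$ such that for every $u\in\mathscr{D}(F)\cap B_\rho(\bar u)$ ($B_\rho(\bar u)$ the ball of radius $\rho$ around $\bar u$) $$\|F(u)-F(\bar u)-F'(\bar u)(u-\bar u)\|\le c\,D_h^\xi(u,\bar u).$$ $F'(\bar u):U\to H$ is the (linear) derivative and $F'(\bar u)^*:H\to U^*$ its adjoint, $\langle F'(\bar u)^*v,u\rangle=\langle v,F'(\bar u)u\rangle_H$.
   Formalization: Each rate is stated for minimizers that eventually lie in the ball B_ρ(ū) where (N) holds; without this the claim fails, e.g. when a second h-minimizing solution outside the ball attracts the minimizers. *)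

theory Defs
  imports "HOL-Analysis.Analysis" "HOL-Library.Landau_Symbols"
begin

definition infinite_dimensional :: "'a::real_vector itself \<Rightarrow> bool" where
  "infinite_dimensional _ \<longleftrightarrow> \<not> (\<exists>B :: 'a set. finite B \<and> span B = UNIV)"

text \<open>``Weaker'' is not meant strictly: the norm topology itself qualifies.\<close>

definition weaker_than_norm_topology :: "'a::real_normed_vector topology \<Rightarrow> bool" where
  "weaker_than_norm_topology \<tau> \<longleftrightarrow> topspace \<tau> = UNIV \<and> (\<forall>S. openin \<tau> S \<longrightarrow> open S)"

text \<open>The penalty \<open>h : U \<rightarrow> [0,+\<infinity>]\<close> takes values in \<^typ>\<open>ennreal\<close>, so that it is
  bounded from below by its type. On the effective domain its real value is \<open>enn2real (h u)\<close>;
  off the effective domain \<open>enn2real (h u) = 0\<close> carries no meaning.\<close>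

definition effective_domain :: "('u \<Rightarrow> ennreal) \<Rightarrow> 'u set" where
  "effective_domain h = {u. h u < \<infinity>}"

definition convex_functional :: "('u::real_vector \<Rightarrow> ennreal) \<Rightarrow> bool" where
  "convex_functional h \<longleftrightarrow>
     (\<forall>u v t. 0 \<le> t \<and> t \<le> 1 \<longrightarrow>
        h ((1 - t) *\<^sub>R u + t *\<^sub>R v) \<le> ennreal (1 - t) * h u + ennreal t * h v)"

definition lower_semicontinuous_in :: "'u topology \<Rightarrow> ('u \<Rightarrow> ennreal) \<Rightarrow> bool" where
  "lower_semicontinuous_in \<tau> h \<longleftrightarrow> (\<forall>c. closedin \<tau> {u \<in> topspace \<tau>. h u \<le> c})"

definition subdifferential ::
  "('u::real_normed_vector \<Rightarrow> ennreal) \<Rightarrow> 'u \<Rightarrow> ('u \<Rightarrow>\<^sub>L real) set" where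
  "subdifferential h u =
     {\<xi>. u \<in> effective_domain h \<and>
         (\<forall>v. ereal (enn2real (h u) + blinfun_apply \<xi> (v - u)) \<le> enn2ereal (h v))}"

text \<open>Meaningful for \<open>u, v \<in> effective_domain h\<close> and \<open>\<xi> \<in> subdifferential h u\<close>.\<close>

definition bregman_distance ::
  "('u::real_normed_vector \<Rightarrow> ennreal) \<Rightarrow> ('u \<Rightarrow>\<^sub>L real) \<Rightarrow> 'u \<Rightarrow> 'u \<Rightarrow> real" where
  "bregman_distance h \<xi> v u = enn2real (h v) - enn2real (h u) - blinfun_apply \<xi> (v - u)"

definition tikhonov_functional ::
  "('u \<Rightarrow> 'h::real_normed_vector) \<Rightarrow> ('u \<Rightarrow> ennreal) \<Rightarrow> 'h \<Rightarrow> real \<Rightarrow> 'u \<Rightarrow> ennreal" where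
  "tikhonov_functional F h z \<alpha> u = ennreal (1/2 * (norm (F u - z))\<^sup>2) + ennreal \<alpha> * h u"

definition tikhonov_minimizer ::
  "'u set \<Rightarrow> ('u \<Rightarrow> 'h::real_normed_vector) \<Rightarrow> ('u \<Rightarrow> ennreal) \<Rightarrow> 'h \<Rightarrow> real \<Rightarrow> 'u \<Rightarrow> bool" where
  "tikhonov_minimizer D F h z \<alpha> u \<longleftrightarrow> is_arg_min (tikhonov_functional F h z \<alpha>) (\<lambda>v. v \<in> D) u"

text \<open>Compactness of the sublevel sets of the functional with data \<open>z\<close>; the limit of the
  convergent subsequence is not required to belong to the sublevel set.\<close>

definition tikhonov_sublevels_compact ::
  "'u topology \<Rightarrow> 'u set \<Rightarrow> ('u \<Rightarrow> 'h::real_normed_vector) \<Rightarrow> ('u \<Rightarrow> ennreal) \<Rightarrow> 'h \<Rightarrow> bool" where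
  "tikhonov_sublevels_compact \<tau> D F h z \<longleftrightarrow>
     (\<forall>K>0. \<forall>\<alpha>>0. \<forall>x :: nat \<Rightarrow> 'u.
        (\<forall>n. x n \<in> D \<and> tikhonov_functional F h z \<alpha> (x n) \<le> ennreal K) \<longrightarrow>
        (\<exists>r l. strict_mono (r :: nat \<Rightarrow> nat) \<and> limitin \<tau> (x \<circ> r) l sequentially))"

locale tikhonov_setting =
  fixes \<tau>U :: "'u::banach topology"
    and \<tau>H :: "'h::{real_inner, complete_space} topology"
    and D :: "'u set"
    and F :: "'u \<Rightarrow> 'h"
    and h :: "'u \<Rightarrow> ennreal"
  assumes weaker_U: "weaker_than_norm_topology \<tau>U"
    and weaker_H: "weaker_than_norm_topology \<tau>H"
    and norm_seq_lsc:
      "\<And>x l. limitin \<tau>H x l sequentially \<Longrightarrow>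
         ereal (norm l) \<le> liminf (\<lambda>n. ereal (norm (x n)))"
    and interior_nonempty: "interior D \<noteq> {}"
    and closed_domain: "closedin \<tau>U D"
    and domains_meet: "D \<inter> effective_domain h \<noteq> {}"
    and continuous_F: "continuous_map (subtopology \<tau>U D) \<tau>H F"
    and proper_h: "effective_domain h \<noteq> {}"
    and convex_h: "convex_functional h"
    and lsc_h: "lower_semicontinuous_in \<tau>U h"

definition h_minimizing_solution ::
  "'u set \<Rightarrow> ('u \<Rightarrow> 'h) \<Rightarrow> ('u \<Rightarrow> ennreal) \<Rightarrow> 'h \<Rightarrow> 'u \<Rightarrow> bool" where
  "h_minimizing_solution D F h y ub \<longleftrightarrow>
     ub \<in> effective_domain h \<and> is_arg_min h (\<lambda>u. u \<in> D \<and> F u = y) ub"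

definition has_gateaux_derivative ::
  "('u::real_normed_vector \<Rightarrow> 'h::real_normed_vector) \<Rightarrow> ('u \<Rightarrow>\<^sub>L 'h) \<Rightarrow> 'u \<Rightarrow> bool" where
  "has_gateaux_derivative F A u \<longleftrightarrow>
     (\<forall>v. ((\<lambda>t. (F (u + t *\<^sub>R v) - F u) /\<^sub>R t) \<longlongrightarrow> blinfun_apply A v) (at (0::real)))"

text \<open>The adjoint \<open>H \<rightarrow> U\<^sup>*\<close>, with \<open>H\<^sup>*\<close> identified with \<open>H\<close>:
  \<open>\<langle>dual_adjoint A v, u\<rangle> = \<langle>v, A u\<rangle>\<close>.\<close>

definition dual_adjoint ::
  "('u::real_normed_vector \<Rightarrow>\<^sub>L 'h::real_inner) \<Rightarrow> 'h \<Rightarrow> ('u \<Rightarrow>\<^sub>L real)" where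
  "dual_adjoint A v = blinfun_inner_right v o\<^sub>L A"

text \<open>The nonlinearity bound is only demanded on \<open>effective_domain h\<close>: elsewhere the Bregman
  distance is not defined (or, by convention, \<open>+\<infinity>\<close>), whereas \<open>bregman_distance\<close> would return
  a meaningless number. It says nothing about \<open>F\<close> outside the ball; global minimizers of the
  Tikhonov functional may stay away from \<open>ub\<close> (for instance near a second minimizing solution),
  which is why rates derived from it concern minimizers that eventually lie in the ball.\<close>

definition nonlinearity_bound ::
  "'u set \<Rightarrow> ('u::real_normed_vector \<Rightarrow> 'h::real_normed_vector) \<Rightarrow> ('u \<Rightarrow> ennreal) \<Rightarrow>
   ('u \<Rightarrow>\<^sub>L 'h) \<Rightarrow> ('u \<Rightarrow>\<^sub>L real) \<Rightarrow> 'u \<Rightarrow> real \<Rightarrow> real \<Rightarrow> bool" where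
  "nonlinearity_bound D F h A \<xi> ub \<rho> c \<longleftrightarrow>
     (\<forall>u \<in> D \<inter> ball ub \<rho> \<inter> effective_domain h.
        norm (F u - F ub - blinfun_apply A (u - ub)) \<le> c * bregman_distance h \<xi> u ub)"

text \<open>Frechet sense. Finiteness of \<open>h\<close> on \<open>V\<close> is part of the notion, since \<open>enn2real\<close>
  sends \<open>\<infinity>\<close> to \<open>0\<close>.\<close>

definition twice_differentiable_on ::
  "'u::real_normed_vector set \<Rightarrow> ('u \<Rightarrow> ennreal) \<Rightarrow>
   ('u \<Rightarrow> ('u \<Rightarrow>\<^sub>L real)) \<Rightarrow> ('u \<Rightarrow> ('u \<Rightarrow>\<^sub>L ('u \<Rightarrow>\<^sub>L real))) \<Rightarrow> bool" where
  "twice_differentiable_on V h h' h'' \<longleftrightarrow>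
     V \<subseteq> effective_domain h \<and>
     (\<forall>u\<in>V. ((\<lambda>x. enn2real (h x)) has_derivative blinfun_apply (h' u)) (at u) \<and>
            (h' has_derivative blinfun_apply (h'' u)) (at u))"

end

theory Submission
  imports Defs
begin

text \<open>Compare the minimizer with \<open>v = ub - \<alpha> \<omega>\<close>. Writing \<open>w = F'(ub) \<omega>\<close>, the source
  condition turns the linear part of \<open>h\<close> into an inner product with \<open>w\<close>; completing the square
  on both sides of the minimality inequality cancels the terms \<open>\<alpha>\<^sup>2 \<parallel>w\<parallel>\<^sup>2\<close> and
  \<open>\<alpha> \<langle>w, y - z\<rangle>\<close> (with \<open>z\<close> the noisy datum), so that only Bregman distances, linearization
  errors and the squared noise remain. Since \<open>\<xi>\<close> is the derivative of \<open>h\<close> at \<open>ub\<close>, the Bregman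
  distance of \<open>v\<close> is \<open>O(\<alpha>\<^sup>2)\<close>, and the one of the minimizer is bounded by a multiple of
  \<open>\<delta>\<^sup>2 / \<alpha> + \<alpha>\<^sup>2\<close>.\<close>

section \<open>Real-valued reading of the penalty, the Bregman distance and minimality\<close>

lemma enn2ereal_eq_enn2real:
  assumes "u \<in> effective_domain h"
  shows "enn2ereal (h u) = ereal (enn2real (h u))"
  using assms unfolding effective_domain_def
  by (cases "h u") (auto simp: enn2ereal_ennreal)

lemma bregman_distance_nonneg:
  assumes "\<xi> \<in> subdifferential h u" "v \<in> effective_domain h"
  shows "0 \<le> bregman_distance h \<xi> v u"
proof -
  have "ereal (enn2real (h u) + blinfun_apply \<xi> (v - u)) \<le> enn2ereal (h v)"
    using assms(1) unfolding subdifferential_def by blast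
  then show ?thesis
    using enn2ereal_eq_enn2real[OF assms(2)] unfolding bregman_distance_def by simp
qed

lemma tikhonov_functional_eq_ennreal:
  assumes "u \<in> effective_domain h" "0 \<le> \<alpha>"
  shows "tikhonov_functional F h z \<alpha> u
    = ennreal (1/2 * (norm (F u - z))\<^sup>2 + \<alpha> * enn2real (h u))"
proof -
  have "h u = ennreal (enn2real (h u))"
    using assms(1) by (simp add: effective_domain_def)
  then have "ennreal \<alpha> * h u = ennreal (\<alpha> * enn2real (h u))"
    using assms(2) by (metis ennreal_mult enn2real_nonneg)
  then show ?thesis
    using assms(2) by (simp add: tikhonov_functional_def flip: ennreal_plus)
qed

text \<open>A competitor of finite value makes the value at the minimizer finite, and since \<alpha>
  > 0 this forces the penalty there to be finite too. Only then can minimality, stated in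
  \<open>ennreal\<close>, be read as an inequality between reals.\<close>

lemma tikhonov_minimizer_ineq:
  assumes "tikhonov_minimizer D F h z \<alpha> u" "0 < \<alpha>" "v \<in> D" "v \<in> effective_domain h"
  shows "u \<in> D" "u \<in> effective_domain h"
    "1/2 * (norm (F u - z))\<^sup>2 + \<alpha> * enn2real (h u)
      \<le> 1/2 * (norm (F v - z))\<^sup>2 + \<alpha> * enn2real (h v)"
proof -
  show "u \<in> D"
    using assms(1) by (simp add: tikhonov_minimizer_def is_arg_min_def)
  have le: "tikhonov_functional F h z \<alpha> u \<le> tikhonov_functional F h z \<alpha> v"
    using assms(1,3) by (auto simp: tikhonov_minimizer_def is_arg_min_linorder)
  also have "\<dots> < \<infinity>"
    by (simp only: tikhonov_functional_eq_ennreal[OF assms(4) less_imp_le[OF assms(2)]]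
        infinity_ennreal_def ennreal_less_top)
  finally have "ennreal \<alpha> * h u < top"
    by (simp add: tikhonov_functional_def)
  then show dom: "u \<in> effective_domain h"
    using assms(2) by (auto simp: effective_domain_def ennreal_mult_less_top)
  show "1/2 * (norm (F u - z))\<^sup>2 + \<alpha> * enn2real (h u)
      \<le> 1/2 * (norm (F v - z))\<^sup>2 + \<alpha> * enn2real (h v)"
    using le assms(2)
    unfolding tikhonov_functional_eq_ennreal[OF dom less_imp_le[OF assms(2)]]
      tikhonov_functional_eq_ennreal[OF assms(4) less_imp_le[OF assms(2)]]
    by (subst (asm) ennreal_le_iff) auto
qed

section \<open>Quadratic bound on the Bregman distance along a segment\<close>

text \<open>The Bregman distance to \<open>u\<close> is nonnegative on \<open>V\<close> and vanishes
  at \<open>u\<close>, so \<open>u\<close> is a local minimum and the derivative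
  \<open>A - \<xi>\<close> of this function must be zero there.\<close>

lemma subgradient_eq_derivative:
  assumes xi: "\<xi> \<in> subdifferential h u" and V: "open V" "u \<in> V" "V \<subseteq> effective_domain h"
    and der: "((\<lambda>x. enn2real (h x)) has_derivative blinfun_apply A) (at u)"
  shows "\<xi> = A"
proof -
  have der': "((\<lambda>x. bregman_distance h \<xi> x u) has_derivative (\<lambda>x. A x - \<xi> x)) (at u)"
    unfolding bregman_distance_def
    by (auto intro!: derivative_eq_intros der)
  have "\<forall>x\<in>V. bregman_distance h \<xi> u u \<le> bregman_distance h \<xi> x u"
    using bregman_distance_nonneg[OF xi] V(3) by (auto simp: bregman_distance_def)
  then have "(\<lambda>x. A x - \<xi> x) = (\<lambda>x. 0)"
    using differential_zero_maxmin[OF V(2,1) der'] by blast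
  then show ?thesis
    by (intro blinfun_eqI) (metis eq_iff_diff_eq_0)
qed

text \<open>Second-order Taylor expansion of the Bregman distance along the segment from
  \<open>ub\<close> in direction \<open>- \<omega>\<close>: the orders zero and one vanish, and the
  bound on \<open>h''\<close> controls the remainder. Since \<open>V\<close> is only open, the
  segment is required to lie in it separately.\<close>

lemma bregman_distance_quadratic_bound:
  assumes xi: "\<xi> \<in> subdifferential h ub" and V: "open V" "ub \<in> V"
    and h2: "twice_differentiable_on V h h' h''"
    and bound: "\<And>u v. u \<in> V \<Longrightarrow> h'' u v v \<le> M * (norm v)\<^sup>2"
    and segment: "\<And>s. 0 \<le> s \<Longrightarrow> s \<le> t \<Longrightarrow> ub - s *\<^sub>R \<omega> \<in> V" and "0 < t"
  shows "bregman_distance h \<xi> (ub - t *\<^sub>R \<omega>) ub \<le> M * (norm \<omega>)\<^sup>2 / 2 * t\<^sup>2"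
proof -
  define g where "g s = bregman_distance h \<xi> (ub - s *\<^sub>R \<omega>) ub" for s
  define g1 where "g1 s = \<xi> \<omega> - h' (ub - s *\<^sub>R \<omega>) \<omega>" for s
  define g2 where "g2 s = h'' (ub - s *\<^sub>R \<omega>) \<omega> \<omega>" for s
  \<comment> \<open>\<open>g\<close>, \<open>g1\<close> and \<open>g2\<close> are the Bregman
    distance along the segment and its first two derivatives, packed into the indexed family that
    \<open>Maclaurin\<close> expects.\<close>
  define diff where "diff m = (if m = 0 then g else if m = 1 then g1 else g2)" for m :: nat
  have g1: "(g has_real_derivative g1 s) (at s)" if "0 \<le> s" "s \<le> t" for s
  proof -
    have "((\<lambda>x. enn2real (h x)) has_derivative h' (ub - s *\<^sub>R \<omega>)) (at (ub - s *\<^sub>R \<omega>))"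
      using h2 segment[OF that] by (simp add: twice_differentiable_on_def)
    moreover have "((\<lambda>s. ub - s *\<^sub>R \<omega>) has_derivative (\<lambda>s. - s *\<^sub>R \<omega>)) (at s)"
      by (auto intro!: derivative_eq_intros)
    ultimately have "((\<lambda>s. enn2real (h (ub - s *\<^sub>R \<omega>))) has_derivative
        (\<lambda>r. h' (ub - s *\<^sub>R \<omega>) (- r *\<^sub>R \<omega>))) (at s)"
      using has_derivative_compose by fast
    then have "((\<lambda>s. enn2real (h (ub - s *\<^sub>R \<omega>)) - enn2real (h ub) + s * \<xi> \<omega>) has_derivative
        (\<lambda>r. h' (ub - s *\<^sub>R \<omega>) (- r *\<^sub>R \<omega>) + r * \<xi> \<omega>)) (at s)"
      by (auto intro!: derivative_eq_intros)
    moreover have "g = (\<lambda>s. enn2real (h (ub - s *\<^sub>R \<omega>)) - enn2real (h ub) + s * \<xi> \<omega>)"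
      by (simp add: fun_eq_iff g_def bregman_distance_def blinfun.scaleR_right blinfun.minus_right)
    moreover have "(\<lambda>r. h' (ub - s *\<^sub>R \<omega>) (- r *\<^sub>R \<omega>) + r * \<xi> \<omega>) = (*) (g1 s)"
      by (simp add: fun_eq_iff g1_def blinfun.scaleR_right blinfun.minus_right left_diff_distrib)
    ultimately show ?thesis
      unfolding has_field_derivative_def by simp
  qed
  have g2: "(g1 has_real_derivative g2 s) (at s)" if "0 \<le> s" "s \<le> t" for s
  proof -
    have "(h' has_derivative h'' (ub - s *\<^sub>R \<omega>)) (at (ub - s *\<^sub>R \<omega>))"
      using h2 segment[OF that] by (simp add: twice_differentiable_on_def)
    moreover have "((\<lambda>s. ub - s *\<^sub>R \<omega>) has_derivative (\<lambda>s. - s *\<^sub>R \<omega>)) (at s)"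
      by (auto intro!: derivative_eq_intros)
    ultimately have "((\<lambda>s. h' (ub - s *\<^sub>R \<omega>)) has_derivative
        (\<lambda>r. h'' (ub - s *\<^sub>R \<omega>) (- r *\<^sub>R \<omega>))) (at s)"
      using has_derivative_compose by fast
    then have "((\<lambda>s. h' (ub - s *\<^sub>R \<omega>) \<omega>) has_derivative
        (\<lambda>r. h'' (ub - s *\<^sub>R \<omega>) (- r *\<^sub>R \<omega>) \<omega>)) (at s)"
      by (rule bounded_linear.has_derivative[OF blinfun.bounded_linear_left])
    then have "(g1 has_derivative (\<lambda>r. - h'' (ub - s *\<^sub>R \<omega>) (- r *\<^sub>R \<omega>) \<omega>)) (at s)"
      using has_derivative_diff[OF has_derivative_const[of "\<xi> \<omega>"]]
      by (fastforce simp: g1_def[abs_def])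
    moreover have "(\<lambda>r. - h'' (ub - s *\<^sub>R \<omega>) (- r *\<^sub>R \<omega>) \<omega>) = (*) (g2 s)"
      by (simp add: fun_eq_iff g2_def blinfun.scaleR_right blinfun.minus_right
          blinfun.scaleR_left blinfun.minus_left)
    ultimately show ?thesis
      unfolding has_field_derivative_def by simp
  qed
  have "\<exists>s>0. s < t \<and> g t = (\<Sum>m<2. diff m 0 / fact m * t ^ m) + diff 2 s / fact 2 * t ^ 2"
    using \<open>0 < t\<close> g1 g2
    by (intro Maclaurin) (auto simp: diff_def less_2_cases_iff)
  then obtain s where s: "0 < s" "s < t" and "g t = g 0 + g1 0 * t + g2 s / 2 * t\<^sup>2"
    by (auto simp: diff_def numeral_2_eq_2)
  moreover have "g 0 = 0"
    by (simp add: g_def bregman_distance_def)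
  \<comment> \<open>The first-order term disappears because the subgradient \<xi> coincides with
    \<open>h' ub\<close>.\<close>
  moreover have "g1 0 = 0"
    using subgradient_eq_derivative[OF xi V, of "h' ub"] h2 V(2)
    by (simp add: g1_def twice_differentiable_on_def)
  moreover have "g2 s \<le> M * (norm \<omega>)\<^sup>2"
    unfolding g2_def using s segment by (intro bound) simp
  ultimately show ?thesis
    by (simp add: g_def mult_right_mono)
qed

section \<open>Comparison of the minimizer with the shifted point\<close>

text \<open>This is the completed-square form of the minimality inequality. The factor
  \<open>1 - c * norm (A \<omega>)\<close> is what remains on the left after the linearization error
  at \<open>u\<close> has been absorbed; the smallness of the source element makes it
  positive.\<close>

lemma bregman_distance_minimizer_bound:
  fixes F :: "'u::real_normed_vector \<Rightarrow> 'h::real_inner" and A :: "'u \<Rightarrow>\<^sub>L 'h"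
  assumes xi: "\<xi> \<in> subdifferential h ub" "\<xi> = dual_adjoint A (A \<omega>)"
    and nl: "nonlinearity_bound D F h A \<xi> ub \<rho> c"
    and c: "0 < c" "c * norm (A \<omega>) < 1"
    and min: "tikhonov_minimizer D F h z \<alpha> u" "0 < \<alpha>" "u \<in> ball ub \<rho>"
    and noise: "norm (F ub - z) \<le> \<delta>"
    and v: "v = ub - \<alpha> *\<^sub>R \<omega>" "v \<in> D" "v \<in> ball ub \<rho>" "v \<in> effective_domain h"
  shows "\<alpha> * (1 - c * norm (A \<omega>)) * bregman_distance h \<xi> u ub
    \<le> 1/2 * (\<delta> + c * bregman_distance h \<xi> v ub)\<^sup>2 + 2 * \<alpha> * bregman_distance h \<xi> v ub"
proof -
  define w where "w = A \<omega>"
  define B where "B x = bregman_distance h \<xi> x ub" for x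
  define r where "r x = F x - F ub - A (x - ub)" for x
  note u = tikhonov_minimizer_ineq[OF min(1,2) v(2,4)]
  have r: "norm (r u) \<le> c * B u" "norm (r v) \<le> c * B v"
    using nl u(1,2) min(3) v(2-4) by (auto simp: nonlinearity_bound_def r_def B_def)
  have B: "0 \<le> B v"
    using bregman_distance_nonneg[OF xi(1) v(4)] by (simp add: B_def)
  \<comment> \<open>The source condition gives
    \<open>\<xi> (x - ub) = w \<bullet> A (x - ub)\<close>, and \<open>A (x - ub)\<close> is the
    increment of \<open>F\<close> minus the linearization error \<open>r x\<close>.\<close>
  have h: "enn2real (h x) = B x + enn2real (h ub) + w \<bullet> (F x - F ub - r x)" for x
    by (simp add: B_def bregman_distance_def xi(2) dual_adjoint_def w_def r_def)
  \<comment> \<open>The competitor is chosen so that the linearized data move by exactly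
    \<open>- \<alpha> w\<close>; completing the square at \<open>v\<close> undoes this
    shift.\<close>
  have Fv: "F v - z = (F ub - z + r v) - \<alpha> *\<^sub>R w"
    by (simp add: r_def v(1) w_def blinfun.minus_right blinfun.scaleR_right)
  \<comment> \<open>Each side is the Tikhonov value of its point plus one and the same constant,
    made of \<open>- \<alpha> h(ub)\<close>, \<open>\<alpha> \<langle>w, F ub - z\<rangle>\<close>
    and \<open>\<alpha>^2 / 2\<close> times the squared norm of \<open>w\<close>. So this is
    minimality rewritten.\<close>
  have "1/2 * (norm (F u - z + \<alpha> *\<^sub>R w))\<^sup>2 + \<alpha> * B u - \<alpha> * (w \<bullet> r u)
    \<le> 1/2 * (norm (F ub - z + r v))\<^sup>2 + \<alpha> * B v - \<alpha> * (w \<bullet> r v)"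
  proof -
    have "1/2 * (norm (F u - z + \<alpha> *\<^sub>R w))\<^sup>2 + \<alpha> * B u - \<alpha> * (w \<bullet> r u)
      = 1/2 * (norm (F u - z))\<^sup>2 + \<alpha> * enn2real (h u) - \<alpha> * enn2real (h ub)
        + \<alpha> * (w \<bullet> (F ub - z)) + \<alpha>\<^sup>2 / 2 * (norm w)\<^sup>2"
      unfolding h[of u] power2_norm_eq_inner
      by (simp add: inner_simps inner_commute algebra_simps power2_eq_square)
    moreover have "1/2 * (norm (F ub - z + r v))\<^sup>2 + \<alpha> * B v - \<alpha> * (w \<bullet> r v)
      = 1/2 * (norm (F v - z))\<^sup>2 + \<alpha> * enn2real (h v) - \<alpha> * enn2real (h ub)
        + \<alpha> * (w \<bullet> (F ub - z)) + \<alpha>\<^sup>2 / 2 * (norm w)\<^sup>2"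
    proof -
      have "F v - F ub - r v = - \<alpha> *\<^sub>R w"
        using Fv by (simp add: algebra_simps)
      then have hv: "enn2real (h v) = B v + enn2real (h ub) + w \<bullet> (- \<alpha> *\<^sub>R w)"
        unfolding h[of v] by simp
      show ?thesis
        unfolding hv Fv power2_norm_eq_inner
        by (simp add: inner_simps inner_commute algebra_simps power2_eq_square)
    qed
    ultimately show ?thesis using u(3) by linarith
  qed
  moreover have "\<alpha> * (w \<bullet> r u) \<le> \<alpha> * (c * norm w * B u)"
  proof -
    have "w \<bullet> r u \<le> norm w * norm (r u)" by (rule norm_cauchy_schwarz)
    also have "\<dots> \<le> norm w * (c * B u)" using r(1) by (simp add: mult_left_mono)
    finally show ?thesis using min(2) by (simp add: mult_ac)
  qed
  \<comment> \<open>At \<open>v\<close> the coefficient \<open>c * norm w\<close> is simply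
    estimated by 1, which turns \<open>\<alpha> * B v\<close> into the
    \<open>2 * \<alpha> * B v\<close> of the conclusion.\<close>
  moreover have "- (\<alpha> * (w \<bullet> r v)) \<le> \<alpha> * B v"
  proof -
    have "- (w \<bullet> r v) \<le> norm w * norm (r v)"
      using Cauchy_Schwarz_ineq2[of w "r v"] by linarith
    also have "\<dots> \<le> norm w * (c * B v)" using r(2) by (simp add: mult_left_mono)
    also have "\<dots> = (c * norm w) * B v" by simp
    also have "\<dots> \<le> B v"
      using c(2) B mult_right_mono[of "c * norm w" 1 "B v"] by (simp add: w_def)
    finally show ?thesis using min(2) by (metis mult_left_mono mult_minus_right less_imp_le)
  qed
  moreover have "(norm (F ub - z + r v))\<^sup>2 \<le> (\<delta> + c * B v)\<^sup>2"
    using norm_triangle_ineq[of "F ub - z" "r v"] noise r(2) by (intro power_mono) auto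
  \<comment> \<open>The completed square at the minimizer is discarded from the left side.\<close>
  moreover have "0 \<le> (norm (F u - z + \<alpha> *\<^sub>R w))\<^sup>2" by simp
  moreover have "\<alpha> * (1 - c * norm w) * B u = \<alpha> * B u - \<alpha> * (c * norm w * B u)"
    by (simp add: algebra_simps)
  ultimately show ?thesis
    unfolding B_def[symmetric] w_def[symmetric] by linarith
qed

section \<open>A rate uniform in the noise level and the regularization parameter\<close>

text \<open>Once the distance \<open>b\<close> of the competitor is of order
  \<open>\<alpha>^2\<close>, the right side of the comparison is of order
  \<open>\<delta>^2 + \<alpha>^3\<close>; the fourth power of \<alpha> from the square is lowered to
  the third by \<open>\<alpha> \<le> 1\<close>. The factor \<alpha> is pulled out so that it cancels
  against the one in front of the minimizer's Bregman distance.\<close>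

lemma square_rate_absorption:
  fixes \<alpha> \<delta> c C b :: real
  assumes "0 < \<alpha>" "\<alpha> \<le> 1" "0 < c" "0 \<le> \<delta>" "0 \<le> b" "b \<le> C * \<alpha>\<^sup>2"
  shows "1/2 * (\<delta> + c * b)\<^sup>2 + 2 * \<alpha> * b
    \<le> \<alpha> * ((1 + c\<^sup>2 * C\<^sup>2 + 2 * C) * (\<delta>\<^sup>2 / \<alpha> + \<alpha>\<^sup>2))"
proof -
  \<comment> \<open>The sign of \<open>C\<close> is forced by
    \<open>0 \<le> b \<le> C * \<alpha>^2\<close>.\<close>
  have C: "0 \<le> C"
    using assms by (metis order_trans zero_le_mult_iff not_less zero_less_power order_less_le)
  have "(\<delta> + c * b)\<^sup>2 \<le> (\<delta> + c * (C * \<alpha>\<^sup>2))\<^sup>2"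
    using assms by (intro power_mono add_left_mono mult_left_mono) auto
  also have "\<dots> \<le> 2 * \<delta>\<^sup>2 + 2 * (c * (C * \<alpha>\<^sup>2))\<^sup>2"
    using sum_squares_bound[of \<delta> "c * (C * \<alpha>\<^sup>2)"] by (simp add: power2_sum)
  also have "(c * (C * \<alpha>\<^sup>2))\<^sup>2 = c\<^sup>2 * C\<^sup>2 * \<alpha> ^ 4"
    by (simp add: power_mult_distrib flip: power_mult)
  also have "c\<^sup>2 * C\<^sup>2 * \<alpha> ^ 4 \<le> c\<^sup>2 * C\<^sup>2 * \<alpha> ^ 3"
    using assms power_decreasing[of 3 4 \<alpha>] by (intro mult_left_mono) auto
  finally have "1/2 * (\<delta> + c * b)\<^sup>2 \<le> \<delta>\<^sup>2 + c\<^sup>2 * C\<^sup>2 * \<alpha> ^ 3"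
    by simp
  moreover have "2 * \<alpha> * b \<le> 2 * C * \<alpha> ^ 3"
    using assms mult_left_mono[of b "C * \<alpha>\<^sup>2" "2 * \<alpha>"]
    by (simp add: power2_eq_square power3_eq_cube mult_ac)
  moreover have "\<alpha> * ((1 + c\<^sup>2 * C\<^sup>2 + 2 * C) * (\<delta>\<^sup>2 / \<alpha> + \<alpha>\<^sup>2))
      = (1 + c\<^sup>2 * C\<^sup>2 + 2 * C) * (\<delta>\<^sup>2 + \<alpha> ^ 3)"
    using assms(1) by (simp add: field_simps power2_eq_square power3_eq_cube)
  moreover have "\<dots> = \<delta>\<^sup>2 + (c\<^sup>2 * C\<^sup>2 + 2 * C) * \<delta>\<^sup>2 + \<alpha> ^ 3 + c\<^sup>2 * C\<^sup>2 * \<alpha> ^ 3 + 2 * C * \<alpha> ^ 3"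
    by (simp add: algebra_simps)
  \<comment> \<open>These two products are the surplus created by using a single constant for both
    \<open>\<delta>^2\<close> and \<open>\<alpha>^3\<close>.\<close>
  moreover have "0 \<le> (c\<^sup>2 * C\<^sup>2 + 2 * C) * \<delta>\<^sup>2" "0 \<le> \<alpha> ^ 3"
    using C assms by auto
  ultimately show ?thesis by linarith
qed

text \<open>The constants \<open>K\<close> and \<open>a\<close> are fixed before \<alpha>, \<delta>,
  the datum \<open>z\<close> and the minimizer \<open>u\<close>. Hence the same estimate serves
  noisy data under any parameter choice and, with \<delta> = 0, exact data.\<close>

lemma tikhonov_rate:
  fixes F :: "'u::real_normed_vector \<Rightarrow> 'h::real_inner" and A :: "'u \<Rightarrow>\<^sub>L 'h"
  assumes ub: "ub \<in> interior D" and \<rho>: "0 < \<rho>" and c: "0 < c" "c * norm (A \<omega>) < 1"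
    and xi: "\<xi> \<in> subdifferential h ub" "\<xi> = dual_adjoint A (A \<omega>)"
    and nl: "nonlinearity_bound D F h A \<xi> ub \<rho> c"
    and V: "open V" "ub \<in> V" and h2: "twice_differentiable_on V h h' h''"
    and bound: "\<And>u v. u \<in> V \<Longrightarrow> h'' u v v \<le> M * (norm v)\<^sup>2"
  obtains K a where "0 < a" "0 \<le> K"
    "\<And>\<alpha> \<delta> z u. 0 < \<alpha> \<Longrightarrow> \<alpha> < a \<Longrightarrow> norm (F ub - z) \<le> \<delta> \<Longrightarrow>
      tikhonov_minimizer D F h z \<alpha> u \<Longrightarrow> u \<in> ball ub \<rho> \<Longrightarrow>
      norm (bregman_distance h \<xi> u ub) \<le> K * (\<delta>\<^sup>2 / \<alpha> + \<alpha>\<^sup>2)"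
proof -
  \<comment> \<open>The absolute value keeps \<open>C\<close> nonnegative whatever the sign of
    \<open>M\<close>.\<close>
  define C where "C = \<bar>M\<bar> * (norm \<omega>)\<^sup>2 / 2"
  define q where "q = 1 - c * norm (A \<omega>)"
  define K where "K = (1 + c\<^sup>2 * C\<^sup>2 + 2 * C) / q"
  have C: "0 \<le> C" by (simp add: C_def)
  have q: "0 < q" using c by (simp add: q_def)
  have "open (interior D \<inter> V \<inter> ball ub \<rho>)" using V by auto
  moreover have "ub \<in> interior D \<inter> V \<inter> ball ub \<rho>" using ub V \<rho> by simp
  ultimately obtain e where e: "0 < e" "ball ub e \<subseteq> interior D \<inter> V \<inter> ball ub \<rho>"
    by (meson openE)
  \<comment> \<open>The bound 1 serves the absorption of powers of \<alpha>; the quotient keeps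
    \<open>ub - \<alpha> \<omega>\<close> within distance \<open>e\<close> of \<open>ub\<close>,
    with \<open>1 + norm \<omega>\<close> avoiding a zero denominator when \<omega> = 0.\<close>
  define a where "a = min 1 (e / (1 + norm \<omega>))"
  have a: "0 < a" "a \<le> 1"
    using e(1) by (auto simp: a_def add_pos_nonneg)
  \<comment> \<open>Stated for all parameters from 0 up to \<open>a\<close>, because the Taylor
    expansion needs the whole segment inside \<open>V\<close> and not only its endpoint.\<close>
  have in_ball: "ub - s *\<^sub>R \<omega> \<in> ball ub e" if "0 \<le> s" "s < a" for s
  proof -
    have "s * norm \<omega> \<le> s * (1 + norm \<omega>)" using that by (simp add: mult_left_mono)
    also have "\<dots> < e"
      using that by (simp add: a_def pos_less_divide_eq add_pos_nonneg)
    finally show ?thesis using that by (simp add: dist_norm)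
  qed
  have "norm (bregman_distance h \<xi> u ub) \<le> K * (\<delta>\<^sup>2 / \<alpha> + \<alpha>\<^sup>2)"
    if \<alpha>: "0 < \<alpha>" "\<alpha> < a" and noise: "norm (F ub - z) \<le> \<delta>"
      and min: "tikhonov_minimizer D F h z \<alpha> u" and u: "u \<in> ball ub \<rho>" for \<alpha> \<delta> z u
  proof -
    let ?v = "ub - \<alpha> *\<^sub>R \<omega>"
    let ?B = "bregman_distance h \<xi> ?v ub"
    have "?v \<in> ball ub e" using in_ball \<alpha> by simp
    then have v: "?v \<in> D" "?v \<in> ball ub \<rho>" "?v \<in> V"
      using e(2) interior_subset by blast+
    then have vdom: "?v \<in> effective_domain h"
      using h2 by (auto simp: twice_differentiable_on_def)
    have "?B \<le> M * (norm \<omega>)\<^sup>2 / 2 * \<alpha>\<^sup>2"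
      using in_ball e(2) \<alpha>
      by (intro bregman_distance_quadratic_bound[OF xi(1) V h2 bound]) (auto simp: subset_iff)
    also have "\<dots> \<le> C * \<alpha>\<^sup>2"
      by (simp add: C_def mult_right_mono)
    finally have Bv: "?B \<le> C * \<alpha>\<^sup>2" .
    have "\<alpha> * (q * bregman_distance h \<xi> u ub)
        \<le> 1/2 * (\<delta> + c * ?B)\<^sup>2 + 2 * \<alpha> * ?B"
      using bregman_distance_minimizer_bound[OF xi nl c min \<alpha>(1) u noise refl v(1,2) vdom]
      by (simp add: q_def mult.assoc)
    also have "\<dots> \<le> \<alpha> * ((1 + c\<^sup>2 * C\<^sup>2 + 2 * C) * (\<delta>\<^sup>2 / \<alpha> + \<alpha>\<^sup>2))"
      using \<alpha> a c(1) noise norm_ge_zero[of "F ub - z"] bregman_distance_nonneg[OF xi(1) vdom] Bv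
      by (intro square_rate_absorption) linarith+
    finally have "q * bregman_distance h \<xi> u ub \<le> (1 + c\<^sup>2 * C\<^sup>2 + 2 * C) * (\<delta>\<^sup>2 / \<alpha> + \<alpha>\<^sup>2)"
      using \<alpha>(1) by (simp only: mult_le_cancel_left_pos)
    then have "bregman_distance h \<xi> u ub \<le> K * (\<delta>\<^sup>2 / \<alpha> + \<alpha>\<^sup>2)"
      using q by (simp add: K_def pos_le_divide_eq mult.commute)
    moreover have "0 \<le> bregman_distance h \<xi> u ub"
      using bregman_distance_nonneg[OF xi(1)]
        tikhonov_minimizer_ineq(2)[OF min \<alpha>(1) v(1) vdom] by blast
    ultimately show ?thesis by simp
  qed
  moreover have "0 \<le> K" using C q by (simp add: K_def)
  ultimately show thesis using that a(1) by blast
qed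

section \<open>Parameter choice: balancing \<open>\<delta>^2 / \<alpha>\<close> against
  \<open>\<alpha>^2\<close>\<close>

theorem corollary3p6:
  fixes \<tau>U :: "'u::banach topology"
    and \<tau>H :: "'h::{real_inner, complete_space} topology"
    and D :: "'u set"
    and F :: "'u \<Rightarrow> 'h"
    and F' :: "'u \<Rightarrow> ('u \<Rightarrow>\<^sub>L 'h)"
    and h :: "'u \<Rightarrow> ennreal"
    and h' :: "'u \<Rightarrow> ('u \<Rightarrow>\<^sub>L real)"
    and h'' :: "'u \<Rightarrow> ('u \<Rightarrow>\<^sub>L ('u \<Rightarrow>\<^sub>L real))"
    and y :: 'h
    and yd :: "real \<Rightarrow> 'h"
    and ub \<omega> :: 'u
    and \<xi> :: "'u \<Rightarrow>\<^sub>L real"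
    and \<rho> c M :: real
    and V :: "'u set"
    and u_noisy :: "real \<Rightarrow> real \<Rightarrow> 'u"
    and u_exact :: "real \<Rightarrow> 'u"
  assumes dim_U: "infinite_dimensional TYPE('u)"
    and dim_H: "infinite_dimensional TYPE('h)"
    and setting: "tikhonov_setting \<tau>U \<tau>H D F h"
    and compact_exact: "tikhonov_sublevels_compact \<tau>U D F h y"
    and compact_noisy: "\<And>\<delta>. \<delta> > 0 \<Longrightarrow> tikhonov_sublevels_compact \<tau>U D F h (yd \<delta>)"
    and solution: "h_minimizing_solution D F h y ub"
    and interior_solution: "ub \<in> interior D"
    and gateaux: "\<And>u. u \<in> interior D \<Longrightarrow> has_gateaux_derivative F (F' u) u"
    and rho_pos: "\<rho> > 0"
    and c_pos: "c > 0"
    and xi_subgradient: "\<xi> \<in> subdifferential h ub"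
    and nonlinearity: "nonlinearity_bound D F h (F' ub) \<xi> ub \<rho> c"
    and source_condition: "\<xi> = dual_adjoint (F' ub) (blinfun_apply (F' ub) \<omega>)"
    and source_small: "c * norm (blinfun_apply (F' ub) \<omega>) < 1"
    and V_nbhd: "open V" "ub \<in> V"
    and h_twice_diff: "twice_differentiable_on V h h' h''"
    and M_pos: "M > 0"
    and h''_bound:
      "\<And>u v. u \<in> V \<Longrightarrow> blinfun_apply (blinfun_apply (h'' u) v) v \<le> M * (norm v)\<^sup>2"
    and noise_level: "\<And>\<delta>. \<delta> > 0 \<Longrightarrow> norm (y - yd \<delta>) < \<delta>"
    and minimizer_noisy:
      "\<And>\<alpha> \<delta>. \<alpha> > 0 \<Longrightarrow> \<delta> > 0 \<Longrightarrow> tikhonov_minimizer D F h (yd \<delta>) \<alpha> (u_noisy \<alpha> \<delta>)"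
    and minimizer_exact:
      "\<And>\<alpha>. \<alpha> > 0 \<Longrightarrow> tikhonov_minimizer D F h y \<alpha> (u_exact \<alpha>)"
  shows
    "(\<forall>\<alpha> :: real \<Rightarrow> real.
        (\<forall>\<delta>>0. \<alpha> \<delta> > 0) \<longrightarrow>
        \<alpha> \<in> \<Theta>[at_right 0](\<lambda>\<delta>. \<delta> powr (2/3)) \<longrightarrow>
        (\<forall>\<^sub>F \<delta> in at_right 0. u_noisy (\<alpha> \<delta>) \<delta> \<in> ball ub \<rho>) \<longrightarrow>
        (\<lambda>\<delta>. bregman_distance h \<xi> (u_noisy (\<alpha> \<delta>) \<delta>) ub)
          \<in> O[at_right 0](\<lambda>\<delta>. \<delta> powr (4/3))) \<and>
     ((\<forall>\<^sub>F \<alpha> in at_right 0. u_exact \<alpha> \<in> ball ub \<rho>) \<longrightarrow>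
        (\<lambda>\<alpha>. bregman_distance h \<xi> (u_exact \<alpha>) ub) \<in> O[at_right 0](\<lambda>\<alpha>. \<alpha>\<^sup>2))"
proof -
  have Fub: "F ub = y"
    using solution by (simp add: h_minimizing_solution_def is_arg_min_def)
  obtain K a where a: "0 < a" and K: "0 \<le> K" and
    rate: "\<And>\<alpha> \<delta> z u. 0 < \<alpha> \<Longrightarrow> \<alpha> < a \<Longrightarrow> norm (y - z) \<le> \<delta> \<Longrightarrow>
      tikhonov_minimizer D F h z \<alpha> u \<Longrightarrow> u \<in> ball ub \<rho> \<Longrightarrow>
      norm (bregman_distance h \<xi> u ub) \<le> K * (\<delta>\<^sup>2 / \<alpha> + \<alpha>\<^sup>2)"
    using tikhonov_rate[OF interior_solution rho_pos c_pos source_small xi_subgradient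
        source_condition nonlinearity V_nbhd h_twice_diff h''_bound] Fub
    by metis
  show ?thesis
  proof (intro conjI allI impI)
    fix \<alpha> :: "real \<Rightarrow> real"
    assume pos: "\<forall>\<delta>>0. \<alpha> \<delta> > 0" and theta: "\<alpha> \<in> \<Theta>[at_right 0](\<lambda>\<delta>. \<delta> powr (2/3))"
      and ball: "\<forall>\<^sub>F \<delta> in at_right 0. u_noisy (\<alpha> \<delta>) \<delta> \<in> ball ub \<rho>"
    have ev_pos: "\<forall>\<^sub>F \<delta> in at_right (0::real). 0 < \<delta>"
      by (simp add: eventually_at_right_less)
    \<comment> \<open>The two halves of the order relation have different uses: the upper bound
      controls \<open>\<alpha>^2\<close> and makes \<alpha> eventually smaller than
      \<open>a\<close>, while the lower bound controls \<open>\<delta>^2 / \<alpha>\<close>.\<close>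
    obtain c2 where c2: "0 < c2"
      "\<forall>\<^sub>F \<delta> in at_right 0. norm (\<alpha> \<delta>) \<le> c2 * norm (\<delta> powr (2/3))"
      using theta by (auto dest: bigthetaD1 elim!: landau_o.bigE)
    obtain c1 where c1: "0 < c1"
      "\<forall>\<^sub>F \<delta> in at_right 0. c1 * norm (\<delta> powr (2/3)) \<le> norm (\<alpha> \<delta>)"
      using theta by (auto dest!: bigthetaD2 elim!: landau_omega.bigE)
    \<comment> \<open>The limit is 0 because \<open>0 powr (2/3) = 0\<close>.\<close>
    have "((\<lambda>\<delta>::real. c2 * \<delta> powr (2/3)) \<longlongrightarrow> c2 * 0 powr (2/3)) (at_right 0)"
      by (intro tendsto_intros tendsto_powr')
        (auto simp: eventually_mono[OF ev_pos])
    then have small: "\<forall>\<^sub>F \<delta> in at_right (0::real). c2 * \<delta> powr (2/3) < a"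
      using a by (auto dest: order_tendstoD(2))
    show "(\<lambda>\<delta>. bregman_distance h \<xi> (u_noisy (\<alpha> \<delta>) \<delta>) ub)
        \<in> O[at_right 0](\<lambda>\<delta>. \<delta> powr (4/3))"
    proof (rule bigoI)
      show "\<forall>\<^sub>F \<delta> in at_right 0. norm (bregman_distance h \<xi> (u_noisy (\<alpha> \<delta>) \<delta>) ub)
          \<le> (K * (1 / c1 + c2\<^sup>2)) * norm (\<delta> powr (4/3))"
        using ev_pos ball c1(2) c2(2) small
      proof eventually_elim
        case (elim \<delta>)
        have \<alpha>: "0 < \<alpha> \<delta>" using pos elim(1) by blast
        then have lower: "c1 * \<delta> powr (2/3) \<le> \<alpha> \<delta>" and upper: "\<alpha> \<delta> \<le> c2 * \<delta> powr (2/3)"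
          using elim by simp_all
        have "norm (bregman_distance h \<xi> (u_noisy (\<alpha> \<delta>) \<delta>) ub) \<le> K * (\<delta>\<^sup>2 / \<alpha> \<delta> + (\<alpha> \<delta>)\<^sup>2)"
          using elim \<alpha> upper noise_level[OF elim(1)] minimizer_noisy[OF \<alpha> elim(1)]
          by (intro rate) auto
        also have "\<dots> \<le> K * (\<delta> powr (4/3) / c1 + c2\<^sup>2 * \<delta> powr (4/3))"
        proof (intro mult_left_mono[OF _ K] add_mono)
          \<comment> \<open>The exponent 2/3 is the balancing one: \<open>2 - 2/3\<close> and
            \<open>2 * (2/3)\<close> are both 4/3.\<close>
          have "\<delta>\<^sup>2 = \<delta> powr (4/3) * \<delta> powr (2/3)"
            using elim(1) by (simp flip: powr_add powr_numeral)
          then have "\<delta>\<^sup>2 * c1 = \<delta> powr (4/3) * (c1 * \<delta> powr (2/3))" by simp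
          also have "\<dots> \<le> \<delta> powr (4/3) * \<alpha> \<delta>"
            using lower by (intro mult_left_mono) auto
          finally show "\<delta>\<^sup>2 / \<alpha> \<delta> \<le> \<delta> powr (4/3) / c1"
            using \<alpha> c1(1) by (simp add: field_simps)
          have "(\<alpha> \<delta>)\<^sup>2 \<le> (c2 * \<delta> powr (2/3))\<^sup>2"
            using upper \<alpha> by (intro power_mono) auto
          also have "\<dots> = c2\<^sup>2 * \<delta> powr (4/3)"
            using elim(1) by (simp add: power_mult_distrib power2_eq_square flip: powr_add)
          finally show "(\<alpha> \<delta>)\<^sup>2 \<le> c2\<^sup>2 * \<delta> powr (4/3)" .
        qed
        also have "\<dots> = (K * (1 / c1 + c2\<^sup>2)) * norm (\<delta> powr (4/3))"
          by (simp add: algebra_simps)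
        finally show ?case .
      qed
    qed
  next
    assume ball: "\<forall>\<^sub>F \<alpha> in at_right 0. u_exact \<alpha> \<in> ball ub \<rho>"
    have "\<forall>\<^sub>F \<alpha> in at_right (0::real). \<alpha> \<in> {0<..<a}"
      using a by (rule eventually_at_right_real)
    with ball have "\<forall>\<^sub>F \<alpha> in at_right 0.
        norm (bregman_distance h \<xi> (u_exact \<alpha>) ub) \<le> K * norm (\<alpha>\<^sup>2)"
    proof eventually_elim
      case (elim \<alpha>)
      \<comment> \<open>Exact data are the case of noise bound 0 with datum \<open>y\<close>; the
        term \<open>\<delta>^2 / \<alpha>\<close> vanishes and \<open>K * \<alpha>^2\<close>
        remains.\<close>
      then show ?case
        using rate[of \<alpha> y 0 "u_exact \<alpha>"] minimizer_exact[of \<alpha>] by simp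
    qed
    then show "(\<lambda>\<alpha>. bregman_distance h \<xi> (u_exact \<alpha>) ub) \<in> O[at_right 0](\<lambda>\<alpha>. \<alpha>\<^sup>2)"
      by (rule bigoI)
  qed
qed

end
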